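(* Let $T$ be a finite set, let $S = 2^T$ be the finite Boolean algebra of subsets of $T$, and let $X \subset S^{\mathbb{Z}}$ be a subshift with $B_1(X) = S$. If $X$ is a subalgebra of the Boolean algebra $S^{\mathbb{Z}}$ (with cellwise operations), then $X$ is simple.
   Context: A subshift $X\subset S^{\mathbb{Z}}$ ($S$ a finite set) is a subset that is closed in the product topology and invariant under the shift map $\sigma$, $\sigma(x)_i = x_{i+1}$; $B_1(X)$ is the set of symbols occurring in points of $X$. The order on $2^T$ is set inclusion, with operations $\cap,\cup$, complement, $0=\emptyset$, $1=T$. The Boolean algebra structure on $S^{\mathbb{Z}}$ is cellwise: $f(x^1,\dots,x^n)_i = f(x^1_i,\dots,x^n_i)$ for every operation $f$. A subalgebra is a subset closed under all operations. For $t \in T$ define $\pi_t : X \to \{0,1\}^{\mathbb{Z}}$ by $\pi_t(x)_i = 1$ if $t \in x_i$ and $\pi_t(x)_i = 0$ if $t\notin x_i$. For $R \subset T$ define $\pi_R : X \to (\{0,1\}^R)^{\mathbb{Z}}$ by $\pi_R(x) = (\pi_t(x))_{t\in R}$. A subshift $X \subset S^{\mathbb{Z}}$, $S=2^T$, is called simple if there exists a set $R \subset T$ such that all of the following hold: (1) for every $t \in T$, either $\pi_t(X) = \{x \in \{0,1\}^{\mathbb{Z}} \mid x = \sigma^n(x)\}$ for some $n \in \mathbb{N}$, or $\pi_t(X) = \{0,1\}^{\mathbb{Z}}$; (2) for all $t \in T$ there exist $r \in R$ and $k \in \mathbb{Z}$ with $\pi_t = \sigma^k \circ \pi_r$; (3)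 if $r \in R$, $x \in \pi_r(X)$ and $y \in \pi_{R \setminus \{r\}}(X)$, then there exists $z \in X$ with $\pi_r(z) = x$ and $\pi_{R\setminus\{r\}}(z) = y$. *)

theory Defs
  imports "HOL-Analysis.Function_Topology"
begin

definition shift :: "(int \<Rightarrow> 'b) \<Rightarrow> (int \<Rightarrow> 'b)" where
  "shift x = (\<lambda>i. x (i + 1))"

text \<open>The integer power \<open>\<sigma>\<^sup>k\<close> of the shift; see \<open>shift_pow_nat\<close> and \<open>shift_pow_neg\<close> below.\<close>

definition shift_pow :: "int \<Rightarrow> (int \<Rightarrow> 'b) \<Rightarrow> (int \<Rightarrow> 'b)" where
  "shift_pow k x = (\<lambda>i. x (i + k))"

lemma shift_pow_nat: "shift_pow (int n) = shift ^^ n"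
  by (induction n) (auto simp: fun_eq_iff shift_def shift_pow_def algebra_simps)

lemma shift_pow_add: "shift_pow j (shift_pow k x) = shift_pow (j + k) x"
  by (simp add: shift_pow_def algebra_simps)

lemma inv_shift: "inv shift = shift_pow (- 1)"
  by (rule inv_equality) (auto simp: fun_eq_iff shift_def shift_pow_def)

lemma shift_pow_neg: "shift_pow (- int n) = inv shift ^^ n"
  by (induction n) (auto simp: inv_shift fun_eq_iff shift_pow_def algebra_simps)

text \<open>Shift invariance means \<open>\<sigma>(X) = X\<close>. Closedness in \<^const>\<open>product_topology\<close> includes
  \<open>X \<subseteq> S\<^sup>\<int>\<close>.\<close>

definition subshift :: "'b set \<Rightarrow> (int \<Rightarrow> 'b) set \<Rightarrow> bool" where
  "subshift S X \<longleftrightarrow>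
     finite S \<and>
     closedin (product_topology (\<lambda>_::int. discrete_topology S) UNIV) X \<and>
     shift ` X = X"

text \<open>The set \<open>B\<^sub>1(X)\<close>.\<close>

definition symbols :: "(int \<Rightarrow> 'b) set \<Rightarrow> 'b set" where
  "symbols X = {x i | x i. x \<in> X}"

definition cellwise_subalgebra :: "'a set \<Rightarrow> (int \<Rightarrow> 'a set) set \<Rightarrow> bool" where
  "cellwise_subalgebra T X \<longleftrightarrow>
     X \<subseteq> (UNIV \<rightarrow> Pow T) \<and>
     (\<lambda>i. {}) \<in> X \<and>
     (\<lambda>i. T) \<in> X \<and>
     (\<forall>x\<in>X. (\<lambda>i. T - x i) \<in> X) \<and>
     (\<forall>x\<in>X. \<forall>y\<in>X. (\<lambda>i. x i \<inter> y i) \<in> X) \<and>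
     (\<forall>x\<in>X. \<forall>y\<in>X. (\<lambda>i. x i \<union> y i) \<in> X)"

text \<open>The binary alphabet \<open>{0, 1}\<close> is the type \<^typ>\<open>bool\<close>, so \<open>{0, 1}\<^sup>\<int>\<close> is
  \<open>UNIV :: (int \<Rightarrow> bool) set\<close>.\<close>

definition proj :: "'a \<Rightarrow> (int \<Rightarrow> 'a set) \<Rightarrow> (int \<Rightarrow> bool)" where
  "proj t x = (\<lambda>i. t \<in> x i)"

text \<open>Elements of \<open>{0, 1}\<^sup>R\<close> are functions that are \<^const>\<open>undefined\<close> outside \<open>R\<close>.\<close>

definition projs :: "'a set \<Rightarrow> (int \<Rightarrow> 'a set) \<Rightarrow> (int \<Rightarrow> 'a \<Rightarrow> bool)" where
  "projs R x = (\<lambda>i. \<lambda>t\<in>R. proj t x i)"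

text \<open>In the first condition the period is taken positive; \<open>n = 0\<close> would give all of
  \<open>{0, 1}\<^sup>\<int>\<close>, which is the other alternative.\<close>

definition simple_subshift :: "'a set \<Rightarrow> (int \<Rightarrow> 'a set) set \<Rightarrow> bool" where
  "simple_subshift T X \<longleftrightarrow>
     subshift (Pow T) X \<and>
     (\<exists>R\<subseteq>T.
        (\<forall>t\<in>T. (\<exists>n::nat. n > 0 \<and> proj t ` X = {x. x = (shift ^^ n) x}) \<or> proj t ` X = UNIV) \<and>
        (\<forall>t\<in>T. \<exists>r\<in>R. \<exists>k::int. \<forall>x\<in>X. proj t x = shift_pow k (proj r x)) \<and>
        (\<forall>r\<in>R. \<forall>x\<in>proj r ` X. \<forall>y\<in>projs (R - {r}) ` X.
           \<exists>z\<in>X. proj r z = x \<and> projs (R - {r}) z = y))"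

end

theory Submission
  imports Defs
begin

text \<open>
  Regard a point of \<open>(2\<^sup>T)\<^sup>\<int>\<close> as a set of coordinates, that is, as a subset of \<open>T \<times> \<int>\<close>.
  A topologically closed subalgebra \<open>X\<close> of such a power set is determined by the equivalence
  relation that identifies two coordinates when no point of \<open>X\<close> tells them apart (\<open>tied\<close>): its
  elements are exactly the unions of equivalence classes (\<open>mem_if_respects_tied\<close>). Indeed, on
  finitely many coordinates any union of classes can be cut out with finite meets and joins of
  separating elements, and closedness passes from finite to infinite sets of coordinates. To
  produce points of \<open>X\<close> it is therefore enough to write down configurations that are constant
  on the classes.

  Shift invariance of \<open>X\<close> makes the relation invariant under translation of \<open>\<int>\<close>, and this
  forces simplicity. The integers \<open>k\<close> for which \<open>(t, 0)\<close> and \<open>(t, k)\<close> are tied form a subgroup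
  of \<open>\<int>\<close>; if it is \<open>n\<int>\<close> with \<open>n > 0\<close>, the track \<open>t\<close> takes precisely the \<open>n\<close>-periodic values,
  and if it is trivial, the track is unconstrained (\<open>proj_image_periodic_or_full\<close>). Call two
  elements of \<open>T\<close> linked when some coordinates above them are tied. Linked tracks are translates
  of one another, whereas tracks that are not linked share no class and can be prescribed
  independently. So a set \<open>R\<close> of representatives of the linkage classes does what is required.
\<close>

section \<open>Closed subalgebras and tied coordinates\<close>

definition tied :: "(int \<Rightarrow> 'a set) set \<Rightarrow> 'a \<Rightarrow> int \<Rightarrow> 'a \<Rightarrow> int \<Rightarrow> bool" where
  "tied X t i s j \<longleftrightarrow> (\<forall>x\<in>X. t \<in> x i \<longleftrightarrow> s \<in> x j)"

lemma tied_refl: "tied X t i t i"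
  and tied_sym: "tied X t i s j \<Longrightarrow> tied X s j t i"
  and tied_trans: "tied X t i s j \<Longrightarrow> tied X s j r k \<Longrightarrow> tied X t i r k"
  by (auto simp: tied_def)

text \<open>A single element may separate two coordinates in the wrong direction; its complement
  then separates them in the right one.\<close>

lemma separating_element:
  assumes alg: "cellwise_subalgebra T X" and "t \<in> T" and "\<not> tied X t i s j"
  shows "\<exists>y\<in>X. t \<in> y i \<and> s \<notin> y j"
proof -
  from assms(3) obtain x where x: "x \<in> X" "(t \<in> x i) \<noteq> (s \<in> x j)"
    by (auto simp: tied_def)
  show ?thesis
  proof (cases "t \<in> x i")
    case True
    with x show ?thesis by blast
  next
    case False
    have "(\<lambda>i. T - x i) \<in> X"
      using alg x(1) by (simp add: cellwise_subalgebra_def)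
    with False x(2) \<open>t \<in> T\<close> show ?thesis
      by (intro bexI[of _ "\<lambda>i. T - x i"]) auto
  qed
qed

lemma separate_point_from_finite:
  assumes alg: "cellwise_subalgebra T X" and "t \<in> T" and "finite G"
    and "\<And>s j. (s, j) \<in> G \<Longrightarrow> \<not> tied X t i s j"
  shows "\<exists>y\<in>X. t \<in> y i \<and> (\<forall>(s, j)\<in>G. s \<notin> y j)"
  using assms(3,4)
proof (induction G)
  case empty
  have "(\<lambda>i. T) \<in> X"
    using alg by (simp add: cellwise_subalgebra_def)
  with \<open>t \<in> T\<close> show ?case by force
next
  case (insert p G)
  obtain s j where p: "p = (s, j)" by force
  have "\<exists>y\<in>X. t \<in> y i \<and> (\<forall>(s, j)\<in>G. s \<notin> y j)"
    by (rule insert.IH) (use insert.prems in simp)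
  then obtain y where y: "y \<in> X" "t \<in> y i" "\<forall>(s, j)\<in>G. s \<notin> y j"
    by blast
  have "\<not> tied X t i s j"
    using insert.prems p by simp
  then obtain w where w: "w \<in> X" "t \<in> w i" "s \<notin> w j"
    using separating_element[OF alg \<open>t \<in> T\<close>] by blast
  have "(\<lambda>i. y i \<inter> w i) \<in> X"
    using alg y(1) w(1) by (simp add: cellwise_subalgebra_def)
  with y w p show ?case
    by (intro bexI[of _ "\<lambda>i. y i \<inter> w i"]) auto
qed

lemma separate_finite_from_finite:
  assumes alg: "cellwise_subalgebra T X" and "finite P" and "finite G"
    and "\<And>t i. (t, i) \<in> P \<Longrightarrow> t \<in> T"
    and "\<And>t i s j. (t, i) \<in> P \<Longrightarrow> (s, j) \<in> G \<Longrightarrow> \<not> tied X t i s j"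
  shows "\<exists>y\<in>X. (\<forall>(t, i)\<in>P. t \<in> y i) \<and> (\<forall>(s, j)\<in>G. s \<notin> y j)"
  using assms(2,4,5)
proof (induction P)
  case empty
  have "(\<lambda>i. {}) \<in> X"
    using alg by (simp add: cellwise_subalgebra_def)
  then show ?case by force
next
  case (insert p P)
  obtain t i where p: "p = (t, i)" by force
  have "\<exists>y\<in>X. (\<forall>(t, i)\<in>P. t \<in> y i) \<and> (\<forall>(s, j)\<in>G. s \<notin> y j)"
    by (rule insert.IH) (use insert.prems in \<open>blast intro: insertI2\<close>)+
  then obtain y where y: "y \<in> X" "\<forall>(t, i)\<in>P. t \<in> y i" "\<forall>(s, j)\<in>G. s \<notin> y j"
    by blast
  have "\<exists>w\<in>X. t \<in> w i \<and> (\<forall>(s, j)\<in>G. s \<notin> w j)"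
    by (rule separate_point_from_finite[OF alg _ \<open>finite G\<close>]) (use insert.prems p in auto)
  then obtain w where w: "w \<in> X" "t \<in> w i" "\<forall>(s, j)\<in>G. s \<notin> w j"
    by blast
  have "(\<lambda>i. y i \<union> w i) \<in> X"
    using alg y(1) w(1) by (simp add: cellwise_subalgebra_def)
  with y w p show ?case
    by (intro bexI[of _ "\<lambda>i. y i \<union> w i"]) auto
qed

text \<open>Closedness in a product of discrete spaces means that a configuration belongs to \<open>X\<close> as
  soon as each of its finite windows is a window of a point of \<open>X\<close>.\<close>

lemma mem_closed_if_finite_windows:
  assumes cl: "closedin (product_topology (\<lambda>_. discrete_topology S) UNIV) X"
    and xS: "\<And>i. x i \<in> S"
    and windows: "\<And>F. finite F \<Longrightarrow> \<exists>y\<in>X. \<forall>i\<in>F. y i = x i"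
  shows "x \<in> X"
proof (rule ccontr)
  let ?\<T> = "product_topology (\<lambda>_. discrete_topology S) UNIV"
  assume "x \<notin> X"
  have "openin ?\<T> (topspace ?\<T> - X)"
    using cl by (simp add: closedin_def)
  moreover have "x \<in> topspace ?\<T> - X"
    using xS \<open>x \<notin> X\<close> by (simp add: PiE_def)
  ultimately have "\<exists>U. finite {i \<in> UNIV. U i \<noteq> topspace (discrete_topology S)} \<and>
      (\<forall>i\<in>UNIV. openin (discrete_topology S) (U i)) \<and>
      x \<in> PiE UNIV U \<and> PiE UNIV U \<subseteq> topspace ?\<T> - X"
    unfolding openin_product_topology_alt by (rule bspec)
  then obtain U where fin: "finite {i. U i \<noteq> S}"
    and U: "x \<in> PiE UNIV U" "PiE UNIV U \<subseteq> topspace ?\<T> - X"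
    by auto
  obtain y where y: "y \<in> X" "\<forall>i\<in>{i. U i \<noteq> S}. y i = x i"
    using windows[OF fin] by blast
  have "y \<in> topspace ?\<T>"
    using closedin_subset[OF cl] y(1) by blast
  then have yS: "y i \<in> S" for i
    by (auto simp: PiE_def)
  have "y i \<in> U i" for i
  proof (cases "U i = S")
    case True
    with yS show ?thesis by simp
  next
    case False
    with y(2) U(1) show ?thesis by (auto simp: PiE_def)
  qed
  then have "y \<in> PiE UNIV U" by auto
  with U(2) y(1) show False by blast
qed

text \<open>On a finite window, the coordinates inside \<open>x\<close> are separated from those outside, because
  no coordinate inside is tied to one outside. The finiteness of \<open>T\<close> makes the set of
  coordinates above a finite window finite.\<close>

lemma mem_if_respects_tied:
  assumes "finite T" and sub: "subshift (Pow T) X" and alg: "cellwise_subalgebra T X"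
    and xT: "\<And>i. x i \<subseteq> T"
    and resp: "\<And>t i s j. t \<in> T \<Longrightarrow> s \<in> T \<Longrightarrow> tied X t i s j \<Longrightarrow> t \<in> x i \<Longrightarrow> s \<in> x j"
  shows "x \<in> X"
proof (rule mem_closed_if_finite_windows)
  show "closedin (product_topology (\<lambda>_. discrete_topology (Pow T)) UNIV) X"
    using sub by (simp add: subshift_def)
  show "x i \<in> Pow T" for i
    using xT by simp
  fix F :: "int set" assume "finite F"
  define P where "P = {(t, i) \<in> T \<times> F. t \<in> x i}"
  define G where "G = {(t, i) \<in> T \<times> F. t \<notin> x i}"
  have fin: "finite P" "finite G"
    using \<open>finite T\<close> \<open>finite F\<close> unfolding P_def G_def
    by (auto intro: finite_subset[of _ "T \<times> F"])
  have "\<exists>y\<in>X. (\<forall>(t, i)\<in>P. t \<in> y i) \<and> (\<forall>(s, j)\<in>G. s \<notin> y j)"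
    using resp by (intro separate_finite_from_finite[OF alg fin]) (auto simp: P_def G_def)
  then obtain y where y: "y \<in> X" "\<forall>(t, i)\<in>P. t \<in> y i" "\<forall>(s, j)\<in>G. s \<notin> y j"
    by blast
  have "y i \<subseteq> T" for i
    using alg y(1) by (auto simp: cellwise_subalgebra_def Pi_def)
  with y xT have "\<forall>i\<in>F. y i = x i"
    unfolding P_def G_def by blast
  with y(1) show "\<exists>y\<in>X. \<forall>i\<in>F. y i = x i" by blast
qed

section \<open>Translation invariance and single tracks\<close>

lemma subshift_shift_pow:
  assumes "subshift S X" and "x \<in> X"
  shows "shift_pow k x \<in> X"
proof (induction k rule: int_induct[where k = 0])
  case base
  show ?case using assms(2) by (simp add: shift_pow_def)
next
  case (step1 k)
  have "shift_pow (k + 1) x = shift (shift_pow k x)"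
    by (simp add: shift_def shift_pow_def algebra_simps)
  with step1 assms(1) show ?case
    by (auto simp: subshift_def)
next
  case (step2 k)
  then obtain y where y: "y \<in> X" "shift_pow k x = shift y"
    using assms(1) by (auto simp: subshift_def)
  have "shift_pow (k - 1) x i = y i" for i
    using fun_cong[OF y(2), of "i - 1"] by (simp add: shift_def shift_pow_def algebra_simps)
  with y(1) show ?case by presburger
qed

lemma tied_translate:
  assumes "subshift S X" and "tied X t i s j"
  shows "tied X t (i + k) s (j + k)"
  unfolding tied_def
proof
  fix x assume "x \<in> X"
  then have "shift_pow k x \<in> X"
    by (rule subshift_shift_pow[OF assms(1)])
  with assms(2) show "t \<in> x (i + k) \<longleftrightarrow> s \<in> x (j + k)"
    by (auto simp: tied_def shift_pow_def)
qed

lemma proj_image_eq_respecting: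
  assumes "finite T" and "subshift (Pow T) X" and "cellwise_subalgebra T X" and "t \<in> T"
  shows "proj t ` X = {w. \<forall>i j. tied X t i t j \<longrightarrow> w i = w j}"
proof (intro equalityI subsetI)
  fix w assume "w \<in> proj t ` X"
  then show "w \<in> {w. \<forall>i j. tied X t i t j \<longrightarrow> w i = w j}"
    by (auto simp: proj_def tied_def)
next
  fix w :: "int \<Rightarrow> bool" assume w: "w \<in> {w. \<forall>i j. tied X t i t j \<longrightarrow> w i = w j}"
  \<comment> \<open>the smallest union of classes that contains \<open>w\<close> placed on the track \<open>t\<close>\<close>
  define z where "z = (\<lambda>j. {s \<in> T. \<exists>i. tied X s j t i \<and> w i})"
  have "z \<in> X"
  proof (rule mem_if_respects_tied[OF assms(1-3)])
    show "z i \<subseteq> T" for i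
      by (auto simp: z_def)
    show "r \<in> z j" if "r \<in> T" "tied X s i r j" "s \<in> z i" for s i r j
      using that tied_trans[OF tied_sym[OF that(2)]] unfolding z_def by blast
  qed
  moreover have "proj t z = w"
    using w \<open>t \<in> T\<close> by (auto simp: proj_def z_def fun_eq_iff intro: tied_refl)
  ultimately show "w \<in> proj t ` X" by blast
qed

lemma periodic_int_multiple:
  fixes f :: "int \<Rightarrow> 'b"
  assumes "\<And>i. f (i + n) = f i"
  shows "f (i + n * m) = f i"
proof (induction m rule: int_induct[where k = 0])
  case base
  show ?case by simp
next
  case (step1 m)
  then show ?case
    using assms[of "i + n * m"] by (simp add: algebra_simps)
next
  case (step2 m)
  then show ?case
    using assms[of "i + n * (m - 1)"] by (simp add: algebra_simps)
qed

text \<open>The least positive \<open>n\<close> with \<open>(t, 0)\<close> and \<open>(t, n)\<close> tied generates all ties within the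
  track, by division with remainder.\<close>

lemma proj_image_periodic_or_full:
  assumes "finite T" and sub: "subshift (Pow T) X" and "cellwise_subalgebra T X" and "t \<in> T"
  shows "(\<exists>n>0. proj t ` X = {x. x = (shift ^^ n) x}) \<or> proj t ` X = UNIV"
proof (cases "\<exists>n::nat. n > 0 \<and> tied X t 0 t (int n)")
  case False
  have not_less: "\<not> i < j" if "tied X t i t j" for i j
  proof
    assume "i < j"
    have "tied X t 0 t (int (nat (j - i)))"
      using tied_translate[OF sub that, of "- i"] \<open>i < j\<close> by simp
    with False \<open>i < j\<close> show False by (auto dest: spec[of _ "nat (j - i)"])
  qed
  have "i = j" if "tied X t i t j" for i j
    using not_less[OF that] not_less[OF tied_sym[OF that]] by simp
  then show ?thesis
    unfolding proj_image_eq_respecting[OF assms] by auto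
next
  case True
  define n where "n = (LEAST n::nat. n > 0 \<and> tied X t 0 t (int n))"
  have n: "n > 0" "tied X t 0 t (int n)"
    using LeastI_ex[OF True] unfolding n_def by auto
  have least: "\<not> tied X t 0 t (int m)" if "0 < m" "m < n" for m
    using not_less_Least[of m] that unfolding n_def by blast
  have tied_n: "tied X t i t (i + int n)" for i
    using tied_translate[OF sub n(2), of i] by (simp add: add.commute)
  have dvd: "int n dvd d" if "tied X t 0 t d" for d
  proof -
    have "t \<in> x 0 \<longleftrightarrow> t \<in> x (d mod int n)" if "x \<in> X" for x
    proof -
      have "t \<in> x (i + int n) \<longleftrightarrow> t \<in> x i" for i
        using tied_n[of i] \<open>x \<in> X\<close> unfolding tied_def by blast
      then have "t \<in> x (d mod int n + int n * (d div int n)) \<longleftrightarrow> t \<in> x (d mod int n)"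
        by (rule periodic_int_multiple[where f = "\<lambda>i. t \<in> x i"])
      with \<open>tied X t 0 t d\<close> \<open>x \<in> X\<close> show ?thesis
        by (simp add: tied_def)
    qed
    then have "tied X t 0 t (int (nat (d mod int n)))"
      using n(1) by (simp add: tied_def)
    moreover have "nat (d mod int n) < n"
      using n(1) by (simp add: nat_less_iff)
    ultimately have "nat (d mod int n) = 0"
      using least by blast
    moreover have "0 \<le> d mod int n"
      using n(1) by simp
    ultimately have "d mod int n = 0"
      by linarith
    then show ?thesis
      by (rule mod_0_imp_dvd)
  qed
  have "(\<forall>i j. tied X t i t j \<longrightarrow> w i = w j) \<longleftrightarrow> w = (shift ^^ n) w" for w :: "int \<Rightarrow> bool"
  proof
    assume "\<forall>i j. tied X t i t j \<longrightarrow> w i = w j"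
    with tied_n have "w i = w (i + int n)" for i
      by blast
    then show "w = (shift ^^ n) w"
      unfolding shift_pow_nat[symmetric] shift_pow_def by (rule ext)
  next
    assume "w = (shift ^^ n) w"
    then have per: "w (i + int n) = w i" for i
      unfolding shift_pow_nat[symmetric] shift_pow_def by (rule fun_cong[OF sym])
    show "\<forall>i j. tied X t i t j \<longrightarrow> w i = w j"
    proof (intro allI impI)
      fix i j assume "tied X t i t j"
      then have "tied X t 0 t (j - i)"
        using tied_translate[OF sub, of t i t j "- i"] by simp
      then obtain m where "j - i = int n * m"
        using dvd by blast
      then have "j = i + int n * m" by simp
      with periodic_int_multiple[of w "int n" i m, OF per] show "w i = w j" by simp
    qed
  qed
  then have "proj t ` X = {x. x = (shift ^^ n) x}"
    unfolding proj_image_eq_respecting[OF assms] by simp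
  with n(1) show ?thesis by blast
qed

section \<open>Linked tracks and simplicity\<close>

definition linked :: "(int \<Rightarrow> 'a set) set \<Rightarrow> 'a \<Rightarrow> 'a \<Rightarrow> bool" where
  "linked X t s \<longleftrightarrow> (\<exists>i j. tied X t i s j)"

lemma linked_sym: "linked X t s \<Longrightarrow> linked X s t"
  unfolding linked_def by (blast intro: tied_sym)

text \<open>The two ties that are to be composed may meet the middle track in different cells;
  a translation aligns them.\<close>

lemma linked_trans:
  assumes "subshift S X" and "linked X t s" and "linked X s r"
  shows "linked X t r"
proof -
  obtain i j j' k where "tied X t i s j" and "tied X s j' r k"
    using assms(2,3) by (auto simp: linked_def)
  then have "tied X t i r (k + (j - j'))"
    using tied_translate[OF assms(1), of s j' r k "j - j'"] tied_trans[of X t i s j] by simp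
  then show ?thesis by (auto simp: linked_def)
qed

lemma linked_imp_proj_shift:
  assumes "subshift S X" and "linked X t r"
  shows "\<exists>k. \<forall>x\<in>X. proj t x = shift_pow k (proj r x)"
proof -
  obtain i j where ij: "tied X t i r j"
    using assms(2) by (auto simp: linked_def)
  have "tied X t l r (l + (j - i))" for l
    using tied_translate[OF assms(1) ij, of "l - i"] by (simp add: algebra_simps)
  then show ?thesis
    by (intro exI[of _ "j - i"]) (auto simp: tied_def proj_def shift_pow_def fun_eq_iff)
qed

theorem theorem1:
  fixes T :: "'a set" and X :: "(int \<Rightarrow> 'a set) set"
  assumes "finite T"
    and "subshift (Pow T) X"
    and "symbols X = Pow T"
    and "cellwise_subalgebra T X"
  shows "simple_subshift T X"
proof -
  note sub = assms(2)
  define rep where "rep t = (SOME s. s \<in> T \<and> linked X t s)" for t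
  have rep: "rep t \<in> T \<and> linked X t (rep t)" if "t \<in> T" for t
    unfolding rep_def
    by (rule someI[of _ t]) (use that in \<open>auto simp: linked_def intro: tied_refl\<close>)
  have rep_cong: "rep t = rep s" if "linked X t s" for t s
  proof -
    have "linked X t r \<longleftrightarrow> linked X s r" for r
      using that by (metis linked_trans[OF sub] linked_sym)
    then show ?thesis by (simp add: rep_def)
  qed
  define R where "R = rep ` T"
  have R: "r \<in> T \<and> rep r = r" if "r \<in> R" for r
    using that rep rep_cong unfolding R_def by (metis imageE)
  have translates: "\<exists>r\<in>R. \<exists>k. \<forall>x\<in>X. proj t x = shift_pow k (proj r x)" if "t \<in> T" for t
    using linked_imp_proj_shift[OF sub] rep[OF that] that unfolding R_def by blast
  have independent: "\<exists>z\<in>X. proj r z = proj r u \<and> projs (R - {r}) z = projs (R - {r}) v"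
    if "r \<in> R" "u \<in> X" "v \<in> X" for r u v
  proof -
    define z where "z = (\<lambda>i. {s \<in> T. if rep s = r then s \<in> u i else s \<in> v i})"
    have "z \<in> X"
    proof (rule mem_if_respects_tied[OF assms(1,2,4)])
      show "z i \<subseteq> T" for i
        by (auto simp: z_def)
      fix t i s j assume "t \<in> T" "s \<in> T" and tied: "tied X t i s j" and "t \<in> z i"
      \<comment> \<open>tied coordinates lie on linked tracks, so both take their values from the same
        one of \<open>u\<close> and \<open>v\<close>\<close>
      have "rep t = rep s"
        using tied by (intro rep_cong) (auto simp: linked_def)
      with tied \<open>s \<in> T\<close> \<open>t \<in> z i\<close> \<open>u \<in> X\<close> \<open>v \<in> X\<close> show "s \<in> z j"
        by (auto simp: z_def tied_def split: if_splits)
    qed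
    moreover have "proj r z = proj r u"
      using R[OF \<open>r \<in> R\<close>] by (simp add: proj_def z_def)
    moreover have "projs (R - {r}) z = projs (R - {r}) v"
      using R by (auto simp: projs_def proj_def z_def fun_eq_iff restrict_def)
    ultimately show ?thesis by blast
  qed
  have "R \<subseteq> T"
    using R by blast
  moreover have "\<forall>t\<in>T. (\<exists>n>0. proj t ` X = {x. x = (shift ^^ n) x}) \<or> proj t ` X = UNIV"
    using proj_image_periodic_or_full[OF assms(1,2,4)] by blast
  moreover have "\<forall>r\<in>R. \<forall>x\<in>proj r ` X. \<forall>y\<in>projs (R - {r}) ` X.
      \<exists>z\<in>X. proj r z = x \<and> projs (R - {r}) z = y"
    using independent by blast
  ultimately show ?thesis
    unfolding simple_subshift_def using sub translates by (intro conjI exI[of _ R]) simp_all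
qed

end
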